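(* Let $\mathfrak{U}$ be a variety of groups and let $\mathfrak{A}$ be the variety of all abelian groups. For an arbitrary countable group $H$ in $\mathfrak{U}$ there exists a two-generated group $G$ in the variety $\mathfrak{U}\mathfrak{A}^2$ with a subnormal subgroup $\tilde H$ such that $\tilde H \cong H$.
   Context: For varieties of groups $\mathfrak{U}, \mathfrak{V}$, the product variety $\mathfrak{U}\mathfrak{V}$ consists of all groups $G$ having a normal subgroup $N \in \mathfrak{U}$ with $G/N \in \mathfrak{V}$; this product is associative, and $\mathfrak{A}^2 = \mathfrak{A}\mathfrak{A}$ is the variety of metabelian groups. A subgroup $S$ of $G$ is subnormal if there is a finite chain $S = S_0 \trianglelefteq S_1 \trianglelefteq \dots \trianglelefteq S_d = G$. A group is two-generated if it can be generated by two elements. Countable groups include finite groups. *)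

theory Defs
  imports "HOL-Algebra.Algebra" "HOL-Library.Countable_Set"
begin

text \<open>
  Words over the alphabet \<open>x\<^sub>0, x\<^sub>0\<^sup>-\<^sup>1, x\<^sub>1, x\<^sub>1\<^sup>-\<^sup>1, \<dots>\<close>: \<open>(i, True)\<close> stands for \<open>x\<^sub>i\<close> and \<open>(i, False)\<close> for
  its inverse. Words need not be reduced, which does not affect their values.
\<close>

type_synonym group_word = "(nat \<times> bool) list"

definition word_value :: "('a, 'm) monoid_scheme \<Rightarrow> (nat \<Rightarrow> 'a) \<Rightarrow> group_word \<Rightarrow> 'a" where
  "word_value G v w =
     foldr (\<lambda>(i, pos) y. (if pos then v i else inv\<^bsub>G\<^esub> (v i)) \<otimes>\<^bsub>G\<^esub> y) w \<one>\<^bsub>G\<^esub>"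

definition satisfies_law :: "('a, 'm) monoid_scheme \<Rightarrow> group_word \<Rightarrow> bool" where
  "satisfies_law G w \<longleftrightarrow> (\<forall>v \<in> UNIV \<rightarrow> carrier G. word_value G v w = \<one>\<^bsub>G\<^esub>)"

text \<open>
  A variety is the class of all groups satisfying a given set of laws. It contains groups over
  all types, so it is represented by its set of laws together with this polymorphic
  membership predicate.
\<close>

definition in_variety :: "group_word set \<Rightarrow> ('a, 'm) monoid_scheme \<Rightarrow> bool" where
  "in_variety U G \<longleftrightarrow> group G \<and> (\<forall>w \<in> U. satisfies_law G w)"

text \<open>
  The class of abelian groups is the predicate \<^const>\<open>comm_group\<close>. It is indeed a variety, with
  the single law \<open>x\<^sub>0 x\<^sub>1 x\<^sub>0\<^sup>-\<^sup>1 x\<^sub>1\<^sup>-\<^sup>1\<close>.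
\<close>

lemma in_variety_commutator_iff_comm_group:
  "in_variety {[(0, True), (1, True), (0, False), (1, False)]} G \<longleftrightarrow> comm_group G"
proof
  assume L: "in_variety {[(0, True), (1, True), (0, False), (1, False)]} G"
  then interpret group G by (simp add: in_variety_def)
  have "x \<otimes>\<^bsub>G\<^esub> y = y \<otimes>\<^bsub>G\<^esub> x" if "x \<in> carrier G" "y \<in> carrier G" for x y
  proof -
    have "(\<lambda>i::nat. if i = 0 then x else y) \<in> UNIV \<rightarrow> carrier G"
      using that by auto
    with L have "word_value G (\<lambda>i. if i = 0 then x else y)
        [(0, True), (1, True), (0, False), (1, False)] = \<one>\<^bsub>G\<^esub>"
      unfolding in_variety_def satisfies_law_def by blast
    then have "(x \<otimes>\<^bsub>G\<^esub> y) \<otimes>\<^bsub>G\<^esub> inv\<^bsub>G\<^esub> (y \<otimes>\<^bsub>G\<^esub> x) = \<one>\<^bsub>G\<^esub>"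
      using that by (simp add: word_value_def m_assoc inv_mult_group)
    then show ?thesis
      using that by (metis inv_equality inv_closed inv_inv m_closed)
  qed
  then show "comm_group G"
    by (intro group_comm_groupI) auto
next
  assume "comm_group G"
  then interpret comm_group G .
  have "x \<otimes>\<^bsub>G\<^esub> (y \<otimes>\<^bsub>G\<^esub> (inv\<^bsub>G\<^esub> x \<otimes>\<^bsub>G\<^esub> inv\<^bsub>G\<^esub> y)) = \<one>\<^bsub>G\<^esub>"
    if "x \<in> carrier G" "y \<in> carrier G" for x y
  proof -
    have "x \<otimes>\<^bsub>G\<^esub> (y \<otimes>\<^bsub>G\<^esub> (inv\<^bsub>G\<^esub> x \<otimes>\<^bsub>G\<^esub> inv\<^bsub>G\<^esub> y)) = (x \<otimes>\<^bsub>G\<^esub> y) \<otimes>\<^bsub>G\<^esub> inv\<^bsub>G\<^esub> (x \<otimes>\<^bsub>G\<^esub> y)"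
      using that by (simp add: m_assoc inv_mult)
    then show ?thesis using that by simp
  qed
  then show "in_variety {[(0, True), (1, True), (0, False), (1, False)]} G"
    by (auto simp: in_variety_def satisfies_law_def word_value_def Pi_iff)
qed

text \<open>
  Membership in the product of two classes. The two arguments have different types because the
  quotient consists of cosets.
\<close>

definition in_product ::
  "('a monoid \<Rightarrow> bool) \<Rightarrow> ('a set monoid \<Rightarrow> bool) \<Rightarrow> 'a monoid \<Rightarrow> bool" where
  "in_product U V G \<longleftrightarrow>
     group G \<and> (\<exists>N. N \<lhd> G \<and> U (G\<lparr>carrier := N\<rparr>) \<and> V (G Mod N))"

definition metabelian :: "'a monoid \<Rightarrow> bool" where
  "metabelian = in_product comm_group comm_group"

definition subnormal :: "'a set \<Rightarrow> ('a, 'm) monoid_scheme \<Rightarrow> bool" where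
  "subnormal S G \<longleftrightarrow> subgroup S G \<and>
     (\<exists>(d::nat) T. T 0 = S \<and> T d = carrier G \<and>
        (\<forall>i<d. subgroup (T i) G \<and> T i \<lhd> G\<lparr>carrier := T (Suc i)\<rparr>))"

definition two_generated :: "('a, 'm) monoid_scheme \<Rightarrow> bool" where
  "two_generated G \<longleftrightarrow> (\<exists>a \<in> carrier G. \<exists>b \<in> carrier G. generate G {a, b} = carrier G)"

end

theory Submission imports Defs begin

text \<open>
  Let \<open>G\<close> be the permutation group on \<open>H \<times> \<int> \<times> \<int>\<close> generated by two elements: the translation of the
  columns \<open>(h, m, n) \<mapsto> (h, m, n + 1)\<close>, and an element \<open>c\<close> which shifts column 0 upwards by one and
  multiplies the points at positive height of column \<open>2 i + 1\<close> by \<open>h\<^sub>i\<close>, where \<open>h\<^sub>0, h\<^sub>1, \<dots>\<close>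
  enumerates \<open>H\<close>. Conjugating \<open>c\<close> by the translation to the power \<open>2 i + 1\<close> puts the step function
  with value \<open>h\<^sub>i\<close> on column 0, and its commutator with \<open>c\<close> is multiplication by \<open>h\<^sub>i\<close> at a single
  point. So \<open>G\<close> contains a copy of \<open>H\<close> acting at this point, which is normal in the subgroup of all
  elements of \<open>G\<close> that do not move the points of \<open>\<int> \<times> \<int>\<close>. That subgroup lies in a power of \<open>H\<close>,
  and the quotient by it embeds in the metabelian wreath product of two infinite cyclic groups.
\<close>

section \<open>Word values, homomorphisms and laws\<close>

lemma word_value_closed:
  assumes "group G" "v \<in> UNIV \<rightarrow> carrier G"
  shows "word_value G v w \<in> carrier G"
proof -
  interpret group G by fact
  from assms(2) have "v i \<in> carrier G" for i by auto
  then show ?thesis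
    by (induction w) (auto simp: word_value_def)
qed

lemma word_value_append:
  assumes "group G" "v \<in> UNIV \<rightarrow> carrier G"
  shows "word_value G v (u @ w) = word_value G v u \<otimes>\<^bsub>G\<^esub> word_value G v w"
proof -
  interpret group G by fact
  from assms(2) have v: "v i \<in> carrier G" for i by auto
  have cl: "word_value G v u \<in> carrier G" for u
    using word_value_closed[OF assms] .
  have value_Cons: "word_value G v ((i, b) # u) = (if b then v i else inv\<^bsub>G\<^esub> (v i)) \<otimes>\<^bsub>G\<^esub> word_value G v u"
    for i b u by (simp add: word_value_def)
  show ?thesis
  proof (induction u)
    case Nil
    have "word_value G v [] = \<one>\<^bsub>G\<^esub>" by (simp add: word_value_def)
    then show ?case using cl by simp
  next
    case (Cons a u)
    then show ?case using cl v by (cases a) (simp add: value_Cons m_assoc)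
  qed
qed

lemma word_value_hom:
  assumes "group G" "group H" "f \<in> hom G H" "v \<in> UNIV \<rightarrow> carrier G"
  shows "f (word_value G v w) = word_value H (f \<circ> v) w"
proof -
  interpret group_hom G H f
    using assms by (simp add: group_hom_def group_hom_axioms_def)
  from assms(4) have v: "v i \<in> carrier G" for i by auto
  show ?thesis
  proof (induction w)
    case Nil
    then show ?case by (simp add: word_value_def)
  next
    case (Cons a w)
    obtain i b where [simp]: "a = (i, b)" by (cases a)
    have "word_value G v w \<in> carrier G"
      by (rule word_value_closed) (use assms in auto)
    then show ?case
      using v Cons by (simp add: word_value_def)
  qed
qed

text \<open>Together the \<open>f i\<close> embed \<open>G\<close> into a power of \<open>H\<close>,
  and laws pass to powers and subgroups: every \<open>f i\<close> sends a value of a law to a value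
  of the same law in \<open>H\<close>, which is trivial.\<close>

lemma in_variety_if_homs_separate:
  fixes f :: "'i \<Rightarrow> 'a \<Rightarrow> 'b"
  assumes "in_variety U H" "group G"
    and hom: "\<And>i. f i \<in> hom G H"
    and sep: "\<And>x. \<lbrakk>x \<in> carrier G; \<And>i. f i x = \<one>\<^bsub>H\<^esub>\<rbrakk> \<Longrightarrow> x = \<one>\<^bsub>G\<^esub>"
  shows "in_variety U G"
proof -
  have H: "group H" using assms(1) by (simp add: in_variety_def)
  have "word_value G v w = \<one>\<^bsub>G\<^esub>" if w: "w \<in> U" and v: "v \<in> UNIV \<rightarrow> carrier G" for v w
  proof (rule sep)
    show "word_value G v w \<in> carrier G"
      by (rule word_value_closed) fact+
    fix i
    have "f i \<circ> v \<in> UNIV \<rightarrow> carrier H"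
      using hom v by (auto simp: hom_def Pi_iff)
    with assms(1) w have "word_value H (f i \<circ> v) w = \<one>\<^bsub>H\<^esub>"
      by (auto simp: in_variety_def satisfies_law_def)
    then show "f i (word_value G v w) = \<one>\<^bsub>H\<^esub>"
      using word_value_hom[OF \<open>group G\<close> H hom v] by simp
  qed
  with \<open>group G\<close> show ?thesis
    by (auto simp: in_variety_def satisfies_law_def)
qed

text \<open>Serves to bound cardinality: there are only countably many words.\<close>

lemma generate_range_subset_word_values:
  assumes "group G" "v \<in> UNIV \<rightarrow> carrier G"
  shows "generate G (range v) \<subseteq> range (word_value G v)"
proof
  interpret group G by fact
  from assms(2) have v: "v i \<in> carrier G" for i by auto
  fix x assume "x \<in> generate G (range v)"
  then show "x \<in> range (word_value G v)"
  proof (induction rule: generate.induct)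
    case one
    have "word_value G v [] = \<one>\<^bsub>G\<^esub>" by (simp add: word_value_def)
    then show ?case by (metis rangeI)
  next
    case (incl h)
    then obtain i where "h = word_value G v [(i, True)]"
      using v by (auto simp: word_value_def)
    then show ?case by blast
  next
    case (inv h)
    then obtain i where "inv\<^bsub>G\<^esub> h = word_value G v [(i, False)]"
      using v by (auto simp: word_value_def)
    then show ?case by blast
  next
    case (eng x y)
    then obtain u w where "x = word_value G v u" "y = word_value G v w" by blast
    then have "x \<otimes>\<^bsub>G\<^esub> y = word_value G v (u @ w)"
      using word_value_append[OF assms] by simp
    then show ?case by blast
  qed
qed

section \<open>Countable groups\<close>

lemma countable_generate:
  assumes "group G" "countable A" "A \<subseteq> carrier G"
  shows "countable (generate G A)"
proof (cases "A = {}")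
  case True
  then show ?thesis
    using group.generate_empty[OF assms(1)] by simp
next
  case False
  then have "range (from_nat_into A) = A"
    using assms(2) by (rule range_from_nat_into)
  moreover from this have "from_nat_into A \<in> UNIV \<rightarrow> carrier G"
    using assms(3) by blast
  ultimately have "generate G A \<subseteq> range (word_value G (from_nat_into A))"
    using generate_range_subset_word_values[OF assms(1)] by metis
  then show ?thesis
    by (rule countable_subset) auto
qed

text \<open>The group structure is transported along an injection of the carrier into the natural
  numbers.\<close>

lemma countable_group_iso_nat_group:
  fixes K :: "('a, 'm) monoid_scheme"
  assumes "group K" "countable (carrier K)"
  obtains G :: "nat monoid" and j where "group G" "j \<in> iso G K"
proof -
  interpret K: group K by fact
  define e where "e = to_nat_on (carrier K)"
  have inj: "inj_on e (carrier K)"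
    using assms(2) unfolding e_def by (rule inj_on_to_nat_on)
  define d where "d = inv_into (carrier K) e"
  have de [simp]: "d (e x) = x" if "x \<in> carrier K" for x
    using inj that by (simp add: d_def)
  define G :: "nat monoid" where
    "G = \<lparr>carrier = e ` carrier K, monoid.mult = \<lambda>x y. e (d x \<otimes>\<^bsub>K\<^esub> d y), one = e \<one>\<^bsub>K\<^esub>\<rparr>"
  have "group G"
  proof (rule groupI)
    fix x assume "x \<in> carrier G"
    then obtain a where "a \<in> carrier K" "x = e a" by (auto simp: G_def)
    then show "\<exists>y\<in>carrier G. y \<otimes>\<^bsub>G\<^esub> x = \<one>\<^bsub>G\<^esub>"
      by (intro bexI[of _ "e (inv\<^bsub>K\<^esub> a)"]) (auto simp: G_def)
  qed (auto simp: G_def K.m_assoc)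
  moreover have "d \<in> iso G K"
    using inj by (auto simp: iso_def hom_def bij_betw_def G_def image_image inj_on_def)
  ultimately show thesis by (rule that)
qed

section \<open>Products with the metabelian variety\<close>

lemma metabelianI:
  assumes "group Q" "comm_group A" "p \<in> hom Q A"
    and comm: "\<And>x y. \<lbrakk>x \<in> kernel Q A p; y \<in> kernel Q A p\<rbrakk> \<Longrightarrow> x \<otimes>\<^bsub>Q\<^esub> y = y \<otimes>\<^bsub>Q\<^esub> x"
  shows "metabelian Q"
proof -
  interpret A: comm_group A by fact
  interpret p: group_hom Q A p
    using assms(1,3) A.is_group by (simp add: group_hom_def group_hom_axioms_def)
  let ?N = "kernel Q A p"
  interpret N: normal ?N Q by (rule p.normal_kernel)
  have "comm_group (Q\<lparr>carrier := ?N\<rparr>)"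
    using p.G.subgroup_imp_group[OF p.subgroup_kernel] comm
    by (intro group.group_comm_groupI) auto
  moreover have "comm_group (Q Mod ?N)"
  proof (rule group.group_comm_groupI[OF N.factorgroup_is_group])
    fix S T assume "S \<in> carrier (Q Mod ?N)" "T \<in> carrier (Q Mod ?N)"
    then obtain x y where [simp]: "x \<in> carrier Q" "y \<in> carrier Q"
      and ST: "S = ?N #>\<^bsub>Q\<^esub> x" "T = ?N #>\<^bsub>Q\<^esub> y"
      by (auto simp: FactGroup_def RCOSETS_def)
    have "p (x \<otimes>\<^bsub>Q\<^esub> y) = p (y \<otimes>\<^bsub>Q\<^esub> x)" by (simp add: A.m_comm)
    then have "?N #>\<^bsub>Q\<^esub> (x \<otimes>\<^bsub>Q\<^esub> y) = ?N #>\<^bsub>Q\<^esub> (y \<otimes>\<^bsub>Q\<^esub> x)"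
      by (intro equalityI p.FactGroup_subset) auto
    then show "S \<otimes>\<^bsub>Q Mod ?N\<^esub> T = T \<otimes>\<^bsub>Q Mod ?N\<^esub> S"
      by (simp add: ST FactGroup_def N.rcos_sum)
  qed
  ultimately show ?thesis
    using N.normal_axioms by (auto simp: metabelian_def in_product_def)
qed

text \<open>The quotient by the kernel of \<open>f\<close> embeds in \<open>M\<close>, which
  \<open>p\<close> exhibits as abelian by abelian. Elements of \<open>M\<close> need not lift to
  \<open>G\<close>, so the abelian kernel and quotient are found inside \<open>G Mod ?N\<close>
  itself.\<close>

lemma in_product_metabelianI:
  assumes "group G" "group M" "f \<in> hom G M" "comm_group A" "p \<in> hom M A"
    and comm: "\<And>x y. \<lbrakk>x \<in> kernel M A p; y \<in> kernel M A p\<rbrakk> \<Longrightarrow> x \<otimes>\<^bsub>M\<^esub> y = y \<otimes>\<^bsub>M\<^esub> x"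
    and U: "U (G\<lparr>carrier := kernel G M f\<rparr>)"
  shows "in_product U metabelian G"
proof -
  interpret A: comm_group A by (rule assms(4))
  interpret f: group_hom G M f
    using assms(1-3) by (simp add: group_hom_def group_hom_axioms_def)
  interpret p: group_hom M A p
    using assms(2,5) A.is_group by (simp add: group_hom_def group_hom_axioms_def)
  let ?N = "kernel G M f"
  interpret N: normal ?N G by (rule f.normal_kernel)
  \<comment> \<open>The composite kills \<open>?N\<close>, so it descends to a homomorphism
    \<open>q\<close> on the quotient, to which \<open>metabelianI\<close> applies.\<close>
  have "?N \<subseteq> kernel G A (p \<circ> f)"
    using p.hom_one by (auto simp only: kernel_def o_apply mem_Collect_eq)
  moreover have "group_hom G A (p \<circ> f)"
    by unfold_locales (rule hom_compose[OF assms(3,5)])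
  ultimately obtain q where q: "q \<in> hom (G Mod ?N) A"
      "\<And>x. x \<in> carrier G \<Longrightarrow> q (?N #>\<^bsub>G\<^esub> x) = (p \<circ> f) x"
    using group_hom.FactGroup_universal_kernel[OF _ N.normal_axioms] by metis
  have "metabelian (G Mod ?N)"
  proof (rule metabelianI[OF N.factorgroup_is_group assms(4) q(1)])
    fix S T assume "S \<in> kernel (G Mod ?N) A q" "T \<in> kernel (G Mod ?N) A q"
    then have "S \<in> rcosets\<^bsub>G\<^esub> ?N" "T \<in> rcosets\<^bsub>G\<^esub> ?N" and q_one: "q S = \<one>\<^bsub>A\<^esub>" "q T = \<one>\<^bsub>A\<^esub>"
      by (simp_all only: kernel_def[of "G Mod ?N"] mem_Collect_eq) (simp_all add: FactGroup_def)
    then obtain x y where xy: "x \<in> carrier G" "y \<in> carrier G"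
      and ST: "S = ?N #>\<^bsub>G\<^esub> x" "T = ?N #>\<^bsub>G\<^esub> y"
      unfolding RCOSETS_def by blast
    have "p (f x) = \<one>\<^bsub>A\<^esub>" "p (f y) = \<one>\<^bsub>A\<^esub>"
      using q(2) xy q_one unfolding ST by simp_all
    then have "f x \<in> kernel M A p" "f y \<in> kernel M A p"
      using xy by (simp_all only: kernel_def mem_Collect_eq f.hom_closed simp_thms)
    then have "f x \<otimes>\<^bsub>M\<^esub> f y = f y \<otimes>\<^bsub>M\<^esub> f x" by (rule comm)
    then have "f (x \<otimes>\<^bsub>G\<^esub> y) = f (y \<otimes>\<^bsub>G\<^esub> x)"
      using f.hom_mult xy by metis
    then have "?N #>\<^bsub>G\<^esub> (x \<otimes>\<^bsub>G\<^esub> y) = ?N #>\<^bsub>G\<^esub> (y \<otimes>\<^bsub>G\<^esub> x)"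
      by (intro equalityI f.FactGroup_subset) (simp_all add: xy)
    then show "S \<otimes>\<^bsub>G Mod ?N\<^esub> T = T \<otimes>\<^bsub>G Mod ?N\<^esub> S"
      by (simp add: ST xy FactGroup_def N.rcos_sum)
  qed
  with U N.normal_axioms assms(1) show ?thesis
    by (auto simp: in_product_def)
qed

lemma normal_joint_kernel:
  assumes "group G" "group H" and hom: "\<And>i. i \<in> I \<Longrightarrow> f i \<in> hom G H"
  shows "{x \<in> carrier G. \<forall>i\<in>I. f i x = \<one>\<^bsub>H\<^esub>} \<lhd> G"
proof -
  interpret G: group G by fact
  interpret H: group H by fact
  have gh: "group_hom G H (f i)" if "i \<in> I" for i
    using assms that by (simp add: group_hom_def group_hom_axioms_def)
  have cl: "f i x \<in> carrier H" if "i \<in> I" "x \<in> carrier G" for i x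
    using hom that by (auto simp: hom_def)
  show ?thesis
    by (rule G.normal_invI)
      (auto intro!: subgroup.intro simp: group_hom.hom_mult[OF gh] group_hom.hom_inv[OF gh]
        group_hom.hom_one[OF gh] cl)
qed

section \<open>Subgroups of permutational wreath products\<close>

text \<open>
  The unrestricted permutational wreath product, \<open>M\<close> acting on the type \<open>'x\<close>. The pair
  \<open>(\<phi>, g)\<close> encodes the permutation \<open>(h, x) \<mapsto> (\<phi> x \<otimes> h, act g x)\<close> of \<open>H \<times> 'x\<close>.
\<close>

definition wreath ::
  "('a, 'm) monoid_scheme \<Rightarrow> ('g, 'n) monoid_scheme \<Rightarrow> ('g \<Rightarrow> 'x \<Rightarrow> 'x) \<Rightarrow> (('x \<Rightarrow> 'a) \<times> 'g) monoid"
  where "wreath H M act =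
    \<lparr>carrier = (UNIV \<rightarrow> carrier H) \<times> carrier M,
     monoid.mult = \<lambda>(\<phi>, g) (\<psi>, k). (\<lambda>x. \<phi> (act k x) \<otimes>\<^bsub>H\<^esub> \<psi> x, g \<otimes>\<^bsub>M\<^esub> k),
     one = (\<lambda>_. \<one>\<^bsub>H\<^esub>, \<one>\<^bsub>M\<^esub>)\<rparr>"

definition single :: "('a, 'm) monoid_scheme \<Rightarrow> 'x \<Rightarrow> 'a \<Rightarrow> 'x \<Rightarrow> 'a" where
  "single H z h = (\<lambda>_. \<one>\<^bsub>H\<^esub>)(z := h)"

locale wreath_action = H: group H + M: group M
  for H :: "('a, 'm) monoid_scheme" and M :: "('g, 'n) monoid_scheme" +
  fixes act :: "'g \<Rightarrow> 'x \<Rightarrow> 'x"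
  assumes act_one [simp]: "act \<one>\<^bsub>M\<^esub> x = x"
    and act_mult: "\<lbrakk>g \<in> carrier M; k \<in> carrier M\<rbrakk> \<Longrightarrow> act (g \<otimes>\<^bsub>M\<^esub> k) x = act g (act k x)"
begin

abbreviation W where "W \<equiv> wreath H M act"

lemma group_wreath: "group W"
proof (rule groupI)
  fix x assume "x \<in> carrier W"
  then obtain \<phi> g where [simp]: "x = (\<phi>, g)" and \<phi>: "\<And>z. \<phi> z \<in> carrier H" and g: "g \<in> carrier M"
    by (auto simp: wreath_def)
  have "act (inv\<^bsub>M\<^esub> g) (act g z) = z" for z
    using g by (simp flip: act_mult)
  then show "\<exists>y\<in>carrier W. y \<otimes>\<^bsub>W\<^esub> x = \<one>\<^bsub>W\<^esub>"
    \<comment> \<open>The inverse permutation first returns a point along \<open>g\<close> and then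
      undoes the factor used there.\<close>
    using \<phi> g by (intro bexI[of _ "(\<lambda>z. inv\<^bsub>H\<^esub> \<phi> (act (inv\<^bsub>M\<^esub> g) z), inv\<^bsub>M\<^esub> g)"])
      (auto simp: wreath_def)
qed (auto simp: wreath_def Pi_iff act_mult H.m_assoc M.m_assoc)

lemma snd_hom: "snd \<in> hom W M"
  by (auto simp: hom_def wreath_def)

end

locale wreath_embedding = wreath_action H M act + G: group G
  for H :: "('a, 'm) monoid_scheme" and M :: "('g, 'n) monoid_scheme"
    and act :: "'g \<Rightarrow> 'x \<Rightarrow> 'x" and G :: "('b, 'k) monoid_scheme" +
  fixes j
  assumes j_hom: "j \<in> hom G W" and j_inj: "inj_on j (carrier G)"
begin

abbreviation top where "top \<equiv> snd \<circ> j"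

abbreviation base where "base \<equiv> kernel G M top"

definition coord where "coord z x = fst (j x) z"

lemma top_hom: "top \<in> hom G M"
  using j_hom snd_hom by (rule hom_compose)

sublocale top: group_hom G M top
  by unfold_locales (rule top_hom)

lemma group_base: "group (G\<lparr>carrier := base\<rparr>)"
  by (rule G.subgroup_imp_group[OF top.subgroup_kernel])

text \<open>Base elements have trivial second component, so the twist by \<open>act\<close>
  disappears and multiplication is pointwise.\<close>

lemma coord_hom: "coord z \<in> hom (G\<lparr>carrier := base\<rparr>) H"
proof -
  have "j x \<in> carrier W" if "x \<in> carrier G" for x
    using j_hom that by (auto simp: hom_def)
  then have "coord z x \<in> carrier H" if "x \<in> base" for x
    using that by (fastforce simp: coord_def kernel_def wreath_def)
  moreover have "coord z (x \<otimes>\<^bsub>G\<^esub> y) = coord z x \<otimes>\<^bsub>H\<^esub> coord z y" if "x \<in> base" "y \<in> base" for x y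
    using that j_hom
    by (auto simp: coord_def kernel_def wreath_def hom_def split: prod.splits)
  ultimately show ?thesis by (auto simp: hom_def)
qed

lemma base_eqI:
  assumes "x \<in> base" "y \<in> base" "\<And>z. coord z x = coord z y"
  shows "x = y"
proof -
  have "j x = j y"
    using assms by (auto simp: coord_def kernel_def prod_eq_iff)
  then show ?thesis
    using j_inj assms by (auto simp: inj_on_def kernel_def)
qed

lemma in_variety_base:
  assumes "in_variety U H"
  shows "in_variety U (G\<lparr>carrier := base\<rparr>)"
proof (rule in_variety_if_homs_separate[OF assms group_base coord_hom])
  fix x assume x: "x \<in> carrier (G\<lparr>carrier := base\<rparr>)" and 1: "\<And>z. coord z x = \<one>\<^bsub>H\<^esub>"
  have "coord z \<one>\<^bsub>G\<^esub> = \<one>\<^bsub>H\<^esub>" for z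
    using hom_one[OF coord_hom group_base H.is_group] by simp
  with x 1 show "x = \<one>\<^bsub>G\<lparr>carrier := base\<rparr>\<^esub>"
    using subgroup.one_closed[OF top.subgroup_kernel] by (auto intro: base_eqI)
qed

definition coordinate_subgroup where
  "coordinate_subgroup z = {x \<in> base. \<forall>y\<in>-{z}. coord y x = \<one>\<^bsub>H\<^esub>}"

lemma coordinate_subgroup_normal: "coordinate_subgroup z \<lhd> G\<lparr>carrier := base\<rparr>"
  using normal_joint_kernel[OF group_base H.is_group coord_hom, of "-{z}" "\<lambda>y. y"]
  by (simp add: coordinate_subgroup_def)

lemma coordinate_subgroup_subgroup: "subgroup (coordinate_subgroup z) G"
  by (rule G.incl_subgroup[OF top.subgroup_kernel
        normal_imp_subgroup[OF coordinate_subgroup_normal]])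

text \<open>The base is the only intermediate term: it is a kernel in \<open>G\<close>, and the
  coordinate subgroup is a joint kernel of coordinates in the base.\<close>

lemma coordinate_subgroup_subnormal: "subnormal (coordinate_subgroup z) G"
proof -
  define T where
    "T i = (if i = 0 then coordinate_subgroup z else if i = 1 then base else carrier G)" for i :: nat
  have "subgroup (T i) G \<and> T i \<lhd> G\<lparr>carrier := T (Suc i)\<rparr>" if "i < 2" for i
    using that coordinate_subgroup_subgroup coordinate_subgroup_normal
      top.subgroup_kernel top.normal_kernel
    by (auto simp: T_def less_2_cases_iff)
  moreover have "T 0 = coordinate_subgroup z" "T 2 = carrier G"
    by (simp_all add: T_def)
  ultimately show ?thesis
    using coordinate_subgroup_subgroup unfolding subnormal_def by blast
qed

text \<open>The isomorphism is \<open>coord z\<close>: it is injective because all other coordinates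
  are trivial, and the assumption makes it surjective.\<close>

lemma coordinate_subgroup_iso:
  assumes "\<And>h. h \<in> carrier H \<Longrightarrow> (single H z h, \<one>\<^bsub>M\<^esub>) \<in> j ` carrier G"
  shows "G\<lparr>carrier := coordinate_subgroup z\<rparr> \<cong> H"
proof -
  have "coord z \<in> hom (G\<lparr>carrier := coordinate_subgroup z\<rparr>) H"
    using coord_hom[of z] by (auto simp: hom_def coordinate_subgroup_def)
  moreover have "inj_on (coord z) (coordinate_subgroup z)"
  proof (rule inj_onI)
    fix x y assume "x \<in> coordinate_subgroup z" "y \<in> coordinate_subgroup z" "coord z x = coord z y"
    moreover from this have "coord y' x = coord y' y" for y'
      by (cases "y' = z") (auto simp: coordinate_subgroup_def)
    ultimately show "x = y"
      by (intro base_eqI) (auto simp: coordinate_subgroup_def)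
  qed
  moreover have "carrier H \<subseteq> coord z ` coordinate_subgroup z"
  proof
    fix h assume "h \<in> carrier H"
    with assms obtain x where x: "x \<in> carrier G" "j x = (single H z h, \<one>\<^bsub>M\<^esub>)"
      by (metis imageE)
    then have "x \<in> coordinate_subgroup z" "coord z x = h"
      by (auto simp: coordinate_subgroup_def kernel_def coord_def single_def)
    then show "h \<in> coord z ` coordinate_subgroup z" by blast
  qed
  ultimately have "coord z \<in> iso (G\<lparr>carrier := coordinate_subgroup z\<rparr>) H"
    by (auto simp: iso_def bij_betw_def hom_def)
  then show ?thesis by (auto simp: is_iso_def)
qed

end

section \<open>The shift group and the two generators\<close>

text \<open>
  The unrestricted wreath product of two infinite cyclic groups: \<open>(s, k)\<close> shifts column \<open>n\<close> of the
  integer grid by \<open>s n\<close> and then translates all columns by \<open>k\<close>.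
\<close>

definition shift_group :: "((int \<Rightarrow> int) \<times> int) monoid" where
  "shift_group =
    \<lparr>carrier = UNIV,
     monoid.mult = \<lambda>(s, k) (r, l). (\<lambda>n. r n + s (n + l), l + k),
     one = (\<lambda>_. 0, 0)\<rparr>"

definition shift_act :: "(int \<Rightarrow> int) \<times> int \<Rightarrow> int \<times> int \<Rightarrow> int \<times> int" where
  "shift_act = (\<lambda>(s, k) (m, n). (m + s n, n + k))"

lemma group_shift_group: "group shift_group"
proof (rule groupI)
  fix x :: "(int \<Rightarrow> int) \<times> int"
  obtain s k where "x = (s, k)" by (cases x)
  then show "\<exists>y\<in>carrier shift_group. y \<otimes>\<^bsub>shift_group\<^esub> x = \<one>\<^bsub>shift_group\<^esub>"
    by (intro bexI[of _ "(\<lambda>n. - s (n - k), - k)"]) (auto simp: shift_group_def)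
qed (auto simp: shift_group_def algebra_simps)

lemma wreath_action_shift: "group H \<Longrightarrow> wreath_action H shift_group shift_act"
  by (intro wreath_action.intro group_shift_group)
    (auto simp: wreath_action_axioms_def shift_group_def shift_act_def)

lemma snd_hom_shift_group: "snd \<in> hom shift_group integer_group"
  by (auto simp: hom_def shift_group_def integer_group_def)

lemma kernel_snd_shift_group_comm:
  assumes "x \<in> kernel shift_group integer_group snd" "y \<in> kernel shift_group integer_group snd"
  shows "x \<otimes>\<^bsub>shift_group\<^esub> y = y \<otimes>\<^bsub>shift_group\<^esub> x"
  using assms by (cases x, cases y) (auto simp: kernel_def shift_group_def integer_group_def)

text \<open>
  On column 0 this is the unit shift; column \<open>2 i + 1\<close> carries the step function from \<open>\<one>\<close> to \<open>h i\<close>.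
  The conjugate by the \<open>d\<close>-th power of the translation is the same element moved by \<open>d\<close> columns.
\<close>

definition shift_step ::
  "('a, 'm) monoid_scheme \<Rightarrow> (nat \<Rightarrow> 'a) \<Rightarrow> int \<Rightarrow> (int \<times> int \<Rightarrow> 'a) \<times> (int \<Rightarrow> int) \<times> int" where
  "shift_step H h d =
    (\<lambda>(m, n). if m > 0 \<and> n + d > 0 \<and> odd (n + d) then h (nat ((n + d) div 2)) else \<one>\<^bsub>H\<^esub>,
     \<lambda>n. if n + d = 0 then 1 else 0, 0)"

definition translation :: "('a, 'm) monoid_scheme \<Rightarrow> (int \<times> int \<Rightarrow> 'a) \<times> (int \<Rightarrow> int) \<times> int" where
  "translation H = (\<lambda>_. \<one>\<^bsub>H\<^esub>, \<lambda>_. 0, 1)"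

text \<open>On column 0, multiplying before the unit shift uses the condition \<open>m > 0\<close>,
  and multiplying after it uses \<open>m + 1 > 0\<close>. The two orders differ only at height 0, by
  the factor \<open>h i\<close>.\<close>

lemma single_in_generate:
  assumes H: "group H" and h: "\<And>i. h i \<in> carrier H"
  defines "W \<equiv> wreath H shift_group shift_act"
  shows "(single H (0, 0) (h i), \<one>\<^bsub>shift_group\<^esub>)
    \<in> generate W {shift_step H h 0, translation H}" (is "?d \<in> ?K")
proof -
  interpret H: group H by fact
  interpret W: group W
    unfolding W_def using wreath_action.group_wreath[OF wreath_action_shift[OF H]] .
  let ?c = "shift_step H h" and ?t = "translation H"
  have c: "?c d \<in> carrier W" for d
    using h by (auto simp: W_def wreath_def shift_step_def shift_group_def)
  have t: "?t \<in> carrier W"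
    by (auto simp: W_def wreath_def translation_def shift_group_def)
  have d: "?d \<in> carrier W"
    using h by (auto simp: W_def wreath_def shift_group_def single_def)
  have K: "subgroup ?K W"
    using c t by (intro W.generate_is_subgroup) auto
  \<comment> \<open>This says that conjugation by \<open>?t\<close> raises \<open>d\<close> by one;
    without inverses it can be checked componentwise.\<close>
  have tc: "?t \<otimes>\<^bsub>W\<^esub> ?c (d + 1) = ?c d \<otimes>\<^bsub>W\<^esub> ?t" for d
    using h by (auto simp: W_def wreath_def shift_step_def translation_def shift_group_def
        shift_act_def fun_eq_iff algebra_simps)
  have cK: "?c (int k) \<in> ?K" for k
  proof (induction k)
    case 0
    then show ?case by (simp add: generate.incl)
  next
    case (Suc k)
    have "?c (int (Suc k)) = inv\<^bsub>W\<^esub> ?t \<otimes>\<^bsub>W\<^esub> (?c (int k) \<otimes>\<^bsub>W\<^esub> ?t)"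
      using tc[of "int k"] W.inv_solve_left[OF c[of "int k + 1"] t W.m_closed[OF c t]]
      by (simp add: algebra_simps)
    then show ?case
      using Suc by (simp add: generate.intros)
  qed
  \<comment> \<open>The step functions sit in odd columns and are moved by an odd distance, so no column carries
    two of them. Hence column 0 is the only one on which \<open>?c 0\<close> and \<open>?c ?n\<close> do not commute.\<close>
  let ?n = "2 * int i + 1"
  have "?c 0 \<otimes>\<^bsub>W\<^esub> ?c ?n \<otimes>\<^bsub>W\<^esub> ?d = ?c ?n \<otimes>\<^bsub>W\<^esub> ?c 0"
    using h by (auto simp: W_def wreath_def shift_step_def shift_group_def shift_act_def
        single_def fun_eq_iff)
  then have "?d = inv\<^bsub>W\<^esub> (?c 0 \<otimes>\<^bsub>W\<^esub> ?c ?n) \<otimes>\<^bsub>W\<^esub> (?c ?n \<otimes>\<^bsub>W\<^esub> ?c 0)"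
    by (simp only: W.inv_solve_left W.m_closed c d)
  moreover have "?c 0 \<in> ?K" "?c ?n \<in> ?K"
    using cK[of 0] cK[of "2 * i + 1"] by (simp_all add: add.commute)
  ultimately show ?thesis
    using K by (metis subgroup.m_closed subgroup.m_inv_closed)
qed

section \<open>Construction of the two-generated group\<close>

theorem theorem3:
  fixes U :: "group_word set" and H :: "'a monoid"
  assumes "in_variety U H"
    and "countable (carrier H)"
  shows "\<exists>(G :: nat monoid) H'.
           in_product (in_variety U) metabelian G \<and> two_generated G \<and>
           subnormal H' G \<and> G\<lparr>carrier := H'\<rparr> \<cong> H"
proof -
  have "group H" using assms(1) by (simp add: in_variety_def)
  interpret H: group H by fact
  interpret wreath_action H shift_group shift_act
    by (rule wreath_action_shift[OF \<open>group H\<close>])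
  interpret W: group W by (rule group_wreath)
  \<comment> \<open>The enumeration may repeat values, so finite \<open>H\<close> is covered as
    well.\<close>
  define h where "h = from_nat_into (carrier H)"
  have h: "range h = carrier H"
    unfolding h_def using assms(2) by (intro range_from_nat_into) auto
  then have h_cl: "h i \<in> carrier H" for i by auto
  let ?A = "{shift_step H h 0, translation H}"
  have A: "?A \<subseteq> carrier W"
    using h_cl by (auto simp: wreath_def shift_step_def translation_def shift_group_def)
  let ?K = "W\<lparr>carrier := generate W ?A\<rparr>"
  have "group ?K"
    by (rule W.subgroup_imp_group[OF W.generate_is_subgroup[OF A]])
  moreover have "countable (carrier ?K)"
    using countable_generate[OF group_wreath _ A] by simp
  ultimately obtain G :: "nat monoid" and j where G: "group G" and j: "j \<in> iso G ?K"
    by (rule countable_group_iso_nat_group)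
  have j_hom: "j \<in> hom G W" and j_inj: "inj_on j (carrier G)"
    and j_img: "j ` carrier G = generate W ?A"
    using j W.generate_incl[OF A] by (auto simp: iso_def hom_def bij_betw_def)
  interpret wreath_embedding H shift_group shift_act G j
    by (intro wreath_embedding.intro wreath_action_axioms G wreath_embedding_axioms.intro)
      (fact j_hom j_inj)+
  have "in_product (in_variety U) metabelian G"
    using G group_shift_group top_hom abelian_integer_group snd_hom_shift_group
      kernel_snd_shift_group_comm in_variety_base[OF assms(1)]
    by (rule in_product_metabelianI)
  moreover have "two_generated G"
  proof -
    interpret j: group_hom G W j
      by unfold_locales (rule j_hom)
    \<comment> \<open>Injectivity of \<open>j\<close> lets the generating pair of its image be
      pulled back to \<open>G\<close>.\<close>
    obtain a b where ab: "a \<in> carrier G" "b \<in> carrier G"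
        "j a = shift_step H h 0" "j b = translation H"
      using j_img generate.incl[of _ ?A W] by (metis imageE insertCI)
    then have "j ` generate G {a, b} = j ` carrier G"
      using j.generate_img[of "{a, b}"] j_img by simp
    then have "generate G {a, b} = carrier G"
      using j_inj ab G.generate_incl[of "{a, b}"] by (simp add: inj_on_image_eq_iff)
    with ab show ?thesis by (auto simp: two_generated_def)
  qed
  moreover have "(single H (0, 0) x, \<one>\<^bsub>shift_group\<^esub>) \<in> j ` carrier G" if "x \<in> carrier H" for x
  proof -
    from that h obtain i where "x = h i" by auto
    then show ?thesis
      using single_in_generate[of H h i, OF \<open>group H\<close> h_cl] by (simp add: j_img)
  qed
  ultimately show ?thesis
    using coordinate_subgroup_subnormal coordinate_subgroup_iso by blast
qed

end
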